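(* Let $\mathcal H=\bigotimes_{m=1}^M\mathcal H_m$ be a finite-dimensional tensor product of complex Hilbert spaces and let $V=\sum_{i=1}^K V_i$, where each $V_i$ is an orthogonal projection on $\mathcal H$ acting on a subset of the tensor factors $\{\mathcal H_m\}$, $[V_i,V_j]=0$ for all $i\neq j$, and the smallest eigenvalue of each $V_i$ is $0$. Let the system Hamiltonian be $H=\sum_{i=1}^K H_i$ with $H_i=V_i-g_iI$, where $-g_i$ is the smallest eigenvalue of $H_i$. Let the dissipation controls (coupling operators) be $L_i=U_iV_i$, $i=1,\dots,K$, with $U_i$ unitary operators on $\mathcal H$. Let $\{|p\rangle\}$ be an orthonormal basis of the ground space $Z_V$ of $V$. If, for every $i$ and every basis vector $|p\rangle$, $$V_iU_i^\dagger|p\rangle=U_i^\dagger|p\rangle,\qquad V_jU_i^\dagger|p\rangle=0\quad\text{for all } j\neq i,$$ then the set of error operators $\{U_i^\dagger\}_{i=1}^K$ is correctable by the dissipation controls $\{L_i\}$.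
   Context: A density operator is an operator $\rho\geq 0$ on $\mathcal H$ with $\mathrm{trace}(\rho)=1$. $Z_V$ is the space spanned by the ground states of $V$ (the eigenspace of its smallest eigenvalue); for a density operator, $\rho_0\in Z_V$ means that the range of $\rho_0$ is contained in $Z_V$, i.e. $\rho_0=\sum_{p,q}\alpha_{pq}|p\rangle\langle q|$. Given $H$ and coupling operators $L_1,\dots,L_K$, the dynamics is $\dot\rho_t=\mathcal L(\rho_t)$ with $$\mathcal L(\rho)=-\mathrm{i}[H,\rho]+\sum_{j=1}^K\Big(L_j\rho L_j^\dagger-\tfrac12L_j^\dagger L_j\rho-\tfrac12\rho L_j^\dagger L_j\Big).$$ For an operator $X$ on $\mathcal H$, $(X)_t$ denotes the solution at time $t$ of this linear equation with initial value $X$ at $t=0$, i.e. $(X)_t=e^{t\mathcal L}(X)$. A set of error operators $\{E_a\}$ is correctable by the dissipation controls $\{L_i\}$ (automatic quantum error correction) if for every density operator $\rho_0\in Z_V$ and every $a$, $$\lim_{t\to\infty}(E_a\rho_0E_a^\dagger)_t=\rho_0 .$$ *)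

theory Defs
  imports "HOL-Analysis.Analysis"
begin

section \<open>Operators on a finite-dimensional complex Hilbert space\<close>

text \<open>The Hilbert space is \<open>complex ^ 'n\<close> with the sesquilinear form below; operators are matrices
  with respect to the standard basis. The library's inner product on \<open>complex ^ 'n\<close> is the real
  one, and its scalar action \<open>*\<^sub>R\<close> on matrices is real.\<close>

definition cinner :: "complex ^ 'n \<Rightarrow> complex ^ 'n \<Rightarrow> complex" where
  "cinner v w = (\<Sum>i\<in>UNIV. cnj (v $ i) * w $ i)"

definition dagger :: "complex ^ 'n ^ 'm \<Rightarrow> complex ^ 'm ^ 'n"  ("_\<^sup>\<dagger>" [1000] 1000) where
  "A\<^sup>\<dagger> = (\<chi> i j. cnj (A $ j $ i))"

definition cscale :: "complex \<Rightarrow> complex ^ 'n ^ 'm \<Rightarrow> complex ^ 'n ^ 'm"  (infixr "*\<^sub>C" 75) where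
  "c *\<^sub>C A = map_matrix (\<lambda>z. c * z) A"

definition commutator :: "complex ^ 'n ^ 'n \<Rightarrow> complex ^ 'n ^ 'n \<Rightarrow> complex ^ 'n ^ 'n" where
  "commutator A B = A ** B - B ** A"

definition unitary :: "complex ^ 'n ^ 'n \<Rightarrow> bool" where
  "unitary U \<longleftrightarrow> U\<^sup>\<dagger> ** U = mat 1 \<and> U ** U\<^sup>\<dagger> = mat 1"

definition orthogonal_projection :: "complex ^ 'n ^ 'n \<Rightarrow> bool" where
  "orthogonal_projection P \<longleftrightarrow> P ** P = P \<and> P\<^sup>\<dagger> = P"

definition density_operator :: "complex ^ 'n ^ 'n \<Rightarrow> bool" where
  "density_operator \<rho> \<longleftrightarrow>
     \<rho>\<^sup>\<dagger> = \<rho> \<and> (\<forall>v. 0 \<le> Re (cinner v (\<rho> *v v))) \<and> trace \<rho> = 1"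

text \<open>These spectral notions are only used for Hermitian matrices, whose eigenvalues are
  all real.\<close>

definition real_eigenvalue :: "complex ^ 'n ^ 'n \<Rightarrow> real \<Rightarrow> bool" where
  "real_eigenvalue A r \<longleftrightarrow> (\<exists>v. v \<noteq> 0 \<and> A *v v = of_real r *s v)"

definition smallest_eigenvalue :: "complex ^ 'n ^ 'n \<Rightarrow> real \<Rightarrow> bool" where
  "smallest_eigenvalue A r \<longleftrightarrow> real_eigenvalue A r \<and> (\<forall>s. real_eigenvalue A s \<longrightarrow> r \<le> s)"

definition ground_space :: "complex ^ 'n ^ 'n \<Rightarrow> (complex ^ 'n) set" where
  "ground_space A = {v. \<exists>r. smallest_eigenvalue A r \<and> A *v v = of_real r *s v}"

text \<open>\<open>vec.span\<close> is the complex linear span.\<close>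

definition orthonormal_basis_of :: "(complex ^ 'n) set \<Rightarrow> (complex ^ 'n) set \<Rightarrow> bool" where
  "orthonormal_basis_of B Z \<longleftrightarrow>
     (\<forall>p\<in>B. \<forall>q\<in>B. cinner p q = (if p = q then 1 else 0)) \<and> vec.span B = Z"


section \<open>Tensor factors\<close>

text \<open>A presentation of \<open>complex ^ 'n\<close> as the tensor product of \<open>M\<close> factors, the \<open>m\<close>-th of
  dimension \<open>d m\<close>: every \<open>x :: 'n\<close> labels the product basis vector
  \<open>|conf x 1\<rangle> \<otimes> \<dots> \<otimes> |conf x M\<rangle>\<close>, and every such product vector has exactly one label.\<close>

definition tensor_product_labelling ::
    "nat \<Rightarrow> (nat \<Rightarrow> nat) \<Rightarrow> ('n \<Rightarrow> nat \<Rightarrow> nat) \<Rightarrow> bool" where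
  "tensor_product_labelling M d conf \<longleftrightarrow>
     bij_betw conf UNIV (\<Pi>\<^sub>E m\<in>{1..M}. {..<d m})"

text \<open>\<open>A\<close> acts on the factors in \<open>S\<close> only: \<open>A = W \<otimes> I\<close> with \<open>W\<close> an operator on the factors in
  \<open>S\<close>, given by its matrix entries, and \<open>I\<close> the identity on the factors outside \<open>S\<close>.\<close>

definition acts_on_factors ::
    "nat \<Rightarrow> ('n \<Rightarrow> nat \<Rightarrow> nat) \<Rightarrow> nat set \<Rightarrow> complex ^ 'n ^ 'n \<Rightarrow> bool" where
  "acts_on_factors M conf S A \<longleftrightarrow> S \<subseteq> {1..M} \<and>
     (\<exists>W :: (nat \<Rightarrow> nat) \<Rightarrow> (nat \<Rightarrow> nat) \<Rightarrow> complex. \<forall>x y.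
        A $ x $ y =
          (if \<forall>m\<in>{1..M} - S. conf x m = conf y m
           then W (restrict (conf x) S) (restrict (conf y) S) else 0))"


section \<open>Lindblad dynamics and automatic error correction\<close>

definition lindbladian ::
    "nat \<Rightarrow> complex ^ 'n ^ 'n \<Rightarrow> (nat \<Rightarrow> complex ^ 'n ^ 'n) \<Rightarrow> complex ^ 'n ^ 'n \<Rightarrow> complex ^ 'n ^ 'n"
  where
  "lindbladian K H L \<rho> =
     - (\<i> *\<^sub>C commutator H \<rho>)
     + (\<Sum>j=1..K. L j ** \<rho> ** (L j)\<^sup>\<dagger>
          - (1/2) *\<^sub>R ((L j)\<^sup>\<dagger> ** L j ** \<rho>) - (1/2) *\<^sub>R (\<rho> ** (L j)\<^sup>\<dagger> ** L j))"

text \<open>\<open>exp_flow F t X\<close> is \<open>exp (t F) X\<close>. For linear \<open>F\<close> it solves \<open>X' = F X\<close>; see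
  \<open>exp_flow_0\<close> and \<open>exp_flow_deriv\<close> below.\<close>

definition exp_flow :: "('a \<Rightarrow> 'a) \<Rightarrow> real \<Rightarrow> 'a \<Rightarrow> 'a::real_normed_vector" where
  "exp_flow F t X = (\<Sum>k. (t ^ k / fact k) *\<^sub>R (F ^^ k) X)"

text \<open>The ground space of \<open>V\<close> is the code space.\<close>

definition correctable ::
    "complex ^ 'n ^ 'n \<Rightarrow> nat \<Rightarrow> complex ^ 'n ^ 'n \<Rightarrow> (nat \<Rightarrow> complex ^ 'n ^ 'n) \<Rightarrow>
     (complex ^ 'n ^ 'n) set \<Rightarrow> bool" where
  "correctable V K H L Es \<longleftrightarrow>
     (\<forall>\<rho>\<^sub>0. density_operator \<rho>\<^sub>0 \<and> range (\<lambda>v. \<rho>\<^sub>0 *v v) \<subseteq> ground_space V \<longrightarrow>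
       (\<forall>E\<in>Es. ((\<lambda>t. exp_flow (lindbladian K H L) t (E ** \<rho>\<^sub>0 ** E\<^sup>\<dagger>)) \<longlongrightarrow> \<rho>\<^sub>0) at_top))"


section \<open>The exponential series solves the master equation\<close>

lemma funpow_norm_bound:
  fixes F :: "'a \<Rightarrow> 'a::real_normed_vector"
  assumes "bounded_linear F"
  shows "norm ((F ^^ k) x) \<le> onorm F ^ k * norm x"
proof (induction k)
  case 0
  then show ?case by simp
next
  case (Suc k)
  have "norm ((F ^^ Suc k) x) \<le> onorm F * norm ((F ^^ k) x)"
    using onorm[OF assms] by simp
  also have "\<dots> \<le> onorm F * (onorm F ^ k * norm x)"
    by (rule mult_left_mono[OF Suc onorm_pos_le[OF assms]])
  finally show ?case by (simp add: mult.assoc)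
qed

lemma exp_flow_summable:
  fixes F :: "'a \<Rightarrow> 'a::banach"
  assumes "bounded_linear F"
  shows "summable (\<lambda>k. (t ^ k / fact k) *\<^sub>R (F ^^ k) x)"
proof (rule summable_comparison_test')
  show "summable (\<lambda>k. (inverse (fact k) * (\<bar>t\<bar> * onorm F) ^ k) * norm x)"
    by (intro summable_mult2 summable_exp)
  fix k :: nat
  have "norm ((t ^ k / fact k) *\<^sub>R (F ^^ k) x) = (\<bar>t\<bar> ^ k / fact k) * norm ((F ^^ k) x)"
    by (simp add: power_abs)
  also have "\<dots> \<le> (\<bar>t\<bar> ^ k / fact k) * (onorm F ^ k * norm x)"
    by (rule mult_left_mono[OF funpow_norm_bound[OF assms]]) simp
  finally show "norm ((t ^ k / fact k) *\<^sub>R (F ^^ k) x)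
      \<le> (inverse (fact k) * (\<bar>t\<bar> * onorm F) ^ k) * norm x"
    by (simp add: field_simps)
qed

lemma exp_flow_0: "exp_flow F 0 x = x"
proof -
  have "(\<lambda>k. ((0::real) ^ k / fact k) *\<^sub>R (F ^^ k) x) = (\<lambda>k. if k = 0 then x else 0)"
    by auto
  then show ?thesis
    unfolding exp_flow_def using sums_unique[OF sums_single[of 0 "\<lambda>_. x"]] by simp
qed

lemma exp_flow_deriv:
  fixes F :: "'a \<Rightarrow> 'a::euclidean_space"
  assumes F: "bounded_linear F"
  shows "((\<lambda>t. exp_flow F t x) has_vector_derivative F (exp_flow F t x)) (at t)"
proof -
  have comp: "((\<lambda>t. exp_flow F t x \<bullet> b) has_real_derivative F (exp_flow F t x) \<bullet> b) (at t)"
    for b :: 'a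
  proof -
    define c where "c k = ((F ^^ k) x \<bullet> b) / fact k" for k
    have s: "(\<lambda>k. c k * u ^ k) sums (exp_flow F u x \<bullet> b)" for u
      using bounded_linear.sums[OF bounded_linear_inner_left[of b]
          summable_sums[OF exp_flow_summable[OF F, of u x]]]
      by (simp add: exp_flow_def c_def mult.commute)
    have e: "(\<lambda>k. diffs c k * t ^ k) = (\<lambda>k. (F ((t ^ k / fact k) *\<^sub>R (F ^^ k) x)) \<bullet> b)"
      by (rule ext)
        (simp add: diffs_def c_def linear_simps[OF F] divide_simps del: of_nat_Suc)
    have "(\<lambda>k. diffs c k * t ^ k) sums (F (exp_flow F t x) \<bullet> b)"
      unfolding e exp_flow_def
      by (intro bounded_linear.sums[OF bounded_linear_inner_left] bounded_linear.sums[OF F]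
          summable_sums exp_flow_summable F)
    moreover have "((\<lambda>u. \<Sum>k. c k * u ^ k) has_real_derivative (\<Sum>k. diffs c k * t ^ k)) (at t)"
      by (rule termdiffs_strong_converges_everywhere) (rule sums_summable[OF s])
    ultimately show ?thesis
      using s by (simp add: sums_iff)
  qed
  show ?thesis
    unfolding has_vector_derivative_def
    by (subst has_derivative_componentwise_within)
      (use comp in \<open>auto simp: has_field_derivative_def mult.commute[of _ "F _ \<bullet> _"]
        intro!: has_derivative_eq_rhs[OF comp[unfolded has_field_derivative_def]]\<close>)
qed

lemma bounded_linear_lindbladian:
  fixes H :: "complex ^ 'n ^ 'n"
  shows "bounded_linear (lindbladian K H L)"
proof -
  have add: "lindbladian K H L (X + Y) = lindbladian K H L X + lindbladian K H L Y" for X Y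
    by (simp add: lindbladian_def commutator_def cscale_def map_matrix_def vec_eq_iff
        matrix_matrix_mult_def algebra_simps sum.distrib sum_subtractf sum_negf)
  have l: "A ** (r *\<^sub>R X) = r *\<^sub>R (A ** X)" for A X :: "complex ^ 'n ^ 'n" and r
    by (simp add: matrix_matrix_mult_def vec_eq_iff scaleR_sum_right)
  have r: "(r *\<^sub>R X) ** A = r *\<^sub>R (X ** A)" for A X :: "complex ^ 'n ^ 'n" and r
    by (simp add: matrix_matrix_mult_def vec_eq_iff scaleR_sum_right)
  have c: "c *\<^sub>C (r *\<^sub>R X) = r *\<^sub>R (c *\<^sub>C X)" for X :: "complex ^ 'n ^ 'n" and c r
    by (simp add: cscale_def map_matrix_def vec_eq_iff)
  have scl: "lindbladian K H L (s *\<^sub>R X) = s *\<^sub>R lindbladian K H L X" for s X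
    by (simp add: lindbladian_def commutator_def l r c scaleR_sum_right scaleR_add_right
        scaleR_diff_right flip: scaleR_diff_right)
      (simp add: scaleR_diff_right scaleR_sum_right mult.commute)
  show ?thesis
    by (simp add: linear_conv_bounded_linear[symmetric] linear_iff add scl)
qed

end

theory Submission
  imports Defs
begin

text \<open>Put \<open>X = U\<^sub>i\<^sup>\<dagger> \<rho>\<^sub>0 U\<^sub>i\<close>. The hypotheses on \<open>U\<^sub>i\<^sup>\<dagger>|p\<rangle>\<close> give
  \<open>V\<^sub>i X = X = X V\<^sub>i\<close> and \<open>V\<^sub>j X = 0 = X V\<^sub>j\<close> for \<open>j \<noteq> i\<close>, whence the generator maps \<open>X\<close> to
  \<open>\<rho>\<^sub>0 - X\<close>. If every \<open>V\<^sub>j\<close> annihilates the code space, the generator kills \<open>\<rho>\<^sub>0\<close>, and the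
  orbit is \<open>\<rho>\<^sub>0 + exp (-t) (X - \<rho>\<^sub>0)\<close>.

  That \<open>V\<close> is frustration free is a consequence of the hypotheses. A sum of commuting
  projections has no eigenvalue strictly between \<open>0\<close> and \<open>1\<close>, and the nonzero
  vectors \<open>U\<^sub>i\<^sup>\<dagger>|p\<rangle>\<close> are eigenvectors of \<open>V\<close> for the eigenvalue \<open>1\<close>. Were \<open>1\<close> the smallest
  eigenvalue, each \<open>U\<^sub>i\<^sup>\<dagger>\<close> would map the ground space injectively, hence onto, itself, so each
  \<open>V\<^sub>i\<close> would be the identity there; this contradicts \<open>V\<^sub>j U\<^sub>i\<^sup>\<dagger>|p\<rangle> = 0\<close> if \<open>K \<ge> 2\<close>, and the
  smallest eigenvalue of \<open>V\<^sub>1\<close> being \<open>0\<close> if \<open>K = 1\<close>.\<close>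

section \<open>Adjoints, the sesquilinear form and sums of matrices\<close>

lemma dagger_dagger [simp]: "(A\<^sup>\<dagger>)\<^sup>\<dagger> = A"
  by (simp add: dagger_def vec_eq_iff)

lemma dagger_mult: "(A ** B)\<^sup>\<dagger> = B\<^sup>\<dagger> ** A\<^sup>\<dagger>"
  by (simp add: dagger_def matrix_matrix_mult_def vec_eq_iff mult.commute)

lemma dagger_zero [simp]: "0\<^sup>\<dagger> = 0"
  by (simp add: dagger_def vec_eq_iff)

lemma cinner_matrix_right: "cinner v (A *v w) = cinner (A\<^sup>\<dagger> *v v) w"
  unfolding cinner_def matrix_vector_mult_def dagger_def
  by (simp add: sum_distrib_left sum_distrib_right mult_ac) (rule sum.swap)

lemma cinner_self: "cinner v v = of_real ((norm v)\<^sup>2)"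
proof -
  have "cnj z * z = of_real ((norm z)\<^sup>2)" for z
    by (metis complex_norm_square mult.commute)
  then show ?thesis
    unfolding cinner_def norm_vec_def L2_set_def by (simp add: sum_nonneg)
qed

lemma cinner_scale_right: "cinner v (c *s w) = c * cinner v w"
  by (simp add: cinner_def sum_distrib_left mult_ac)

lemma cinner_sum_right: "cinner v (\<Sum>j\<in>I. f j) = (\<Sum>j\<in>I. cinner v (f j))"
  unfolding cinner_def by (simp add: sum_distrib_left) (rule sum.swap)

lemma cinner_projection:
  assumes "orthogonal_projection P"
  shows "cinner v (P *v v) = of_real ((norm (P *v v))\<^sup>2)"
proof -
  have "P *v v = P *v (P *v v)"
    using assms by (simp add: orthogonal_projection_def matrix_vector_mul_assoc)
  then have "cinner v (P *v v) = cinner (P *v v) (P *v v)"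
    using assms by (metis cinner_matrix_right orthogonal_projection_def)
  then show ?thesis by (simp add: cinner_self)
qed

lemma unitary_dagger_eq_0_iff:
  assumes "unitary U"
  shows "U\<^sup>\<dagger> *v v = 0 \<longleftrightarrow> v = 0"
  by (metis assms matrix_vector_mul_assoc matrix_vector_mul_lid matrix_vector_mult_0_right
      unitary_def)

lemma sum_matrix_vector_mult: "(\<Sum>j\<in>I. A j) *v v = (\<Sum>j\<in>I. A j *v v)"
  by (induction I rule: infinite_finite_induct) (simp_all add: matrix_vector_mult_add_rdistrib)

lemma sum_matrix_mult_left: "(\<Sum>j\<in>I. A j) ** X = (\<Sum>j\<in>I. A j ** X)"
  for X :: "complex ^ 'n ^ 'n"
  by (simp add: matrix_eq sum_matrix_vector_mult flip: matrix_vector_mul_assoc)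

lemma sum_matrix_mult_right: "X ** (\<Sum>j\<in>I. A j) = (\<Sum>j\<in>I. X ** A j)"
  for X :: "complex ^ 'n ^ 'n"
  by (simp add: matrix_eq sum_matrix_vector_mult vec.linear_sum[OF matrix_vector_mul_linear_gen]
      flip: matrix_vector_mul_assoc)

section \<open>Ground spaces and the spectrum of a sum of projections\<close>

lemma smallest_eigenvalue_unique:
  "smallest_eigenvalue A r \<Longrightarrow> smallest_eigenvalue A s \<Longrightarrow> r = s"
  unfolding smallest_eigenvalue_def by (meson order_antisym)

lemma ground_space_eq:
  "smallest_eigenvalue A r \<Longrightarrow> ground_space A = {v. A *v v = of_real r *s v}"
  unfolding ground_space_def using smallest_eigenvalue_unique by blast

lemma matrix_vector_eq_on_span:
  assumes "\<And>p. p \<in> B \<Longrightarrow> A *v p = C *v p" and "v \<in> vec.span B"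
  shows "A *v v = C *v v"
  by (rule vec.linear_eq_on_span[OF matrix_vector_mul_linear_gen matrix_vector_mul_linear_gen assms])

text \<open>Pair the eigenvalue equation with \<open>u\<close> under \<open>cinner\<close>: for a
  projection, the form at \<open>u\<close> is the squared norm of the projected vector.\<close>

lemma sum_projections_eigenvector:
  assumes P: "\<And>j. j \<in> I \<Longrightarrow> orthogonal_projection (P j)"
    and u: "(\<Sum>j\<in>I. P j) *v u = of_real r *s u"
  shows "(\<Sum>j\<in>I. (norm (P j *v u))\<^sup>2) = r * (norm u)\<^sup>2"
proof -
  have "complex_of_real (\<Sum>j\<in>I. (norm (P j *v u))\<^sup>2) = (\<Sum>j\<in>I. cinner u (P j *v u))"
    unfolding of_real_sum by (rule sum.cong[OF refl]) (rule cinner_projection[OF P, symmetric])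
  also have "\<dots> = cinner u (of_real r *s u)"
    by (simp add: cinner_sum_right sum_matrix_vector_mult flip: u)
  also have "\<dots> = of_real (r * (norm u)\<^sup>2)"
    by (simp add: cinner_scale_right cinner_self)
  finally show ?thesis
    by (simp only: of_real_eq_iff)
qed

text \<open>The \<open>i\<close>-th squared norm alone already equals that of \<open>u\<close>, and
  the others are nonnegative. This is the source of the spectral gap.\<close>

lemma sum_projections_eigenvector_fixed:
  assumes I: "finite I" "i \<in> I" and P: "\<And>j. j \<in> I \<Longrightarrow> orthogonal_projection (P j)"
    and u: "(\<Sum>j\<in>I. P j) *v u = of_real r *s u" "P i *v u = u" "u \<noteq> 0"
  shows "r \<ge> 1"
proof -
  have "(norm u)\<^sup>2 \<le> (\<Sum>j\<in>I. (norm (P j *v u))\<^sup>2)"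
    using member_le_sum[of i I "\<lambda>j. (norm (P j *v u))\<^sup>2"] I u(2) by simp
  then show ?thesis
    using u(3) by (simp add: sum_projections_eigenvector[OF P u(1)])
qed

lemma frustration_free:
  fixes Vs U :: "nat \<Rightarrow> complex ^ 'n ^ 'n"
  assumes P: "\<And>i. i \<in> {1..K} \<Longrightarrow> orthogonal_projection (Vs i)"
    and comm: "\<And>i j. i \<in> {1..K} \<Longrightarrow> j \<in> {1..K} \<Longrightarrow> i \<noteq> j \<Longrightarrow> commutator (Vs i) (Vs j) = 0"
    and small: "\<And>i. i \<in> {1..K} \<Longrightarrow> smallest_eigenvalue (Vs i) 0"
    and V: "V = (\<Sum>i=1..K. Vs i)"
    and un: "\<And>i. i \<in> {1..K} \<Longrightarrow> unitary (U i)"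
    and fixed: "\<And>i v. i \<in> {1..K} \<Longrightarrow> v \<in> ground_space V \<Longrightarrow>
           Vs i *v ((U i)\<^sup>\<dagger> *v v) = (U i)\<^sup>\<dagger> *v v"
    and kill: "\<And>i j v. i \<in> {1..K} \<Longrightarrow> j \<in> {1..K} \<Longrightarrow> j \<noteq> i \<Longrightarrow> v \<in> ground_space V \<Longrightarrow>
           Vs j *v ((U i)\<^sup>\<dagger> *v v) = 0"
    and v: "v \<in> ground_space V" and i: "i \<in> {1..K}"
  shows "Vs i *v v = 0"
proof (rule ccontr)
  assume nz: "Vs i *v v \<noteq> 0"
  define u where "u = Vs i *v v"
  obtain r where r: "smallest_eigenvalue V r" and vr: "V *v v = of_real r *s v"
    using v by (auto simp: ground_space_def)
  note Z = ground_space_eq[OF r]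
  have sw: "Vs j ** Vs i = Vs i ** Vs j" if "j \<in> {1..K}" for j
    using comm[OF that i] by (cases "j = i") (auto simp: commutator_def)
  \<comment> \<open>Commuting with \<open>V\<close>, the projection \<open>Vs i\<close> keeps
    \<open>v\<close> in the \<open>r\<close>-eigenspace, so the nonzero \<open>u\<close> is an
    eigenvector of \<open>V\<close> that \<open>Vs i\<close> fixes.\<close>
  have "V ** Vs i = Vs i ** V"
    unfolding V sum_matrix_mult_left sum_matrix_mult_right by (rule sum.cong) (simp_all add: sw)
  then have "V *v u = Vs i *v (V *v v)"
    by (simp add: u_def matrix_vector_mul_assoc)
  then have Vu: "V *v u = of_real r *s u"
    by (simp add: vr u_def vec.linear_scale[OF matrix_vector_mul_linear_gen])
  have "Vs i *v u = u"
    using P[OF i] by (simp add: u_def matrix_vector_mul_assoc orthogonal_projection_def)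
  then have r1: "r \<ge> 1"
    using nz Vu[unfolded V] i
    by (intro sum_projections_eigenvector_fixed[where P=Vs and I="{1..K}" and u=u])
      (auto simp: u_def P)
  have fixV: "V *v ((U j)\<^sup>\<dagger> *v x) = (U j)\<^sup>\<dagger> *v x"
    if j: "j \<in> {1..K}" and x: "x \<in> ground_space V" for j x
  proof -
    have "V *v ((U j)\<^sup>\<dagger> *v x) = (\<Sum>k=1..K. if k = j then (U j)\<^sup>\<dagger> *v x else 0)"
      unfolding V sum_matrix_vector_mult using fixed[OF j x] kill[OF j _ _ x]
      by (intro sum.cong) auto
    then show ?thesis using j by simp
  qed
  have "v \<noteq> 0" using nz by auto
  then have nz': "(U j)\<^sup>\<dagger> *v v \<noteq> 0" if "j \<in> {1..K}" for j
    by (simp add: unitary_dagger_eq_0_iff[OF un[OF that]])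
  \<comment> \<open>The vector \<open>(U i)\<^sup>\<dagger> *v v\<close> attains the eigenvalue 1,
    so minimality of \<open>r\<close> gives the bound opposite to \<open>r1\<close>.\<close>
  have "real_eigenvalue V 1"
    unfolding real_eigenvalue_def using fixV[OF i v] nz'[OF i] by auto
  then have r_eq: "r = 1"
    using r r1 by (fastforce simp: smallest_eigenvalue_def)
  \<comment> \<open>With \<open>r = 1\<close>, \<open>fixV\<close> says that
    \<open>(U j)\<^sup>\<dagger>\<close> preserves the ground space. Being injective in finite
    dimension it is onto, so \<open>x\<close> is the image of a ground vector and
    \<open>fixed\<close> applies.\<close>
  have onto: "Vs j *v x = x" if j: "j \<in> {1..K}" and x: "x \<in> ground_space V" for j x
  proof -
    let ?T = "\<lambda>x. (U j)\<^sup>\<dagger> *v x"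
    have sub: "?T ` ground_space V \<subseteq> ground_space V"
      using fixV[OF j] by (auto simp: Z r_eq)
    have ss: "vec.subspace (ground_space V)"
      unfolding Z r_eq
      by (rule vec.subspaceI)
        (simp_all add: matrix_vector_right_distrib
          vec.linear_scale[OF matrix_vector_mul_linear_gen])
    have "inj ?T"
      using un[OF j]
      by (intro inj_on_inverseI[where g="\<lambda>x. U j *v x"])
        (simp add: matrix_vector_mul_assoc unitary_def)
    then have "vec.dim (?T ` ground_space V) = vec.dim (ground_space V)"
      by (intro vec.dim_image_eq[OF matrix_vector_mul_linear_gen]) (auto intro: inj_on_subset)
    then have "?T ` ground_space V = ground_space V"
      using vec.subspace_dim_equal[OF vec.linear_subspace_image[OF matrix_vector_mul_linear_gen ss] ss]
        sub by simp
    then obtain y where "y \<in> ground_space V" "x = ?T y"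
      using x by blast
    then show ?thesis using fixed[OF j] by simp
  qed
  show False
  proof (cases "\<exists>j\<in>{1..K}. j \<noteq> i")
    case True
    then obtain j where j: "j \<in> {1..K}" "j \<noteq> i" by blast
    \<comment> \<open>This nonzero vector is fixed by \<open>Vs j\<close> through
      \<open>onto\<close> and annihilated by it through \<open>kill\<close>.\<close>
    have "(U i)\<^sup>\<dagger> *v v \<in> ground_space V"
      using fixV[OF i v] by (simp add: Z r_eq)
    then show False
      using onto[OF j(1)] kill[OF i j v] nz'[OF i] by simp
  next
    case False
    then have "{1..K} = {i}" using i by blast
    then have "V = Vs i" by (simp add: V)
    then show False
      using small[OF i] r r_eq smallest_eigenvalue_unique by fastforce
  qed
qed

section \<open>Exponential relaxation to a stationary point\<close>

lemma exp_flow_relaxation: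
  fixes F :: "'a \<Rightarrow> 'a::banach"
  assumes F: "bounded_linear F" and R: "F R = 0" and X: "F X = R - X"
  shows "exp_flow F t X = R + exp (- t) *\<^sub>R (X - R)"
proof -
  \<comment> \<open>Split \<open>X = R + (X - R)\<close>: \<open>F\<close> kills \<open>R\<close>
    and negates \<open>X - R\<close>, so \<open>R\<close> survives only in the zeroth power.\<close>
  have pow: "(F ^^ k) X = (if k = 0 then R else 0) + (- 1) ^ k *\<^sub>R (X - R)" for k
  proof (induction k)
    case (Suc k)
    have "(F ^^ Suc k) X = (- 1) ^ k *\<^sub>R (R - X)"
      by (simp add: Suc linear_simps[OF F] R X)
    then show ?case by (simp add: scaleR_diff_right)
  qed simp
  have e: "(\<lambda>k. (t ^ k / fact k) *\<^sub>R (F ^^ k) X) =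
      (\<lambda>k. (if k = 0 then R else 0) + ((- t) ^ k /\<^sub>R fact k) *\<^sub>R (X - R))"
    by (rule ext) (auto simp: pow scaleR_add_right power_minus[of t] divide_inverse mult_ac)
  have "(\<lambda>k. (t ^ k / fact k) *\<^sub>R (F ^^ k) X) sums (R + exp (- t) *\<^sub>R (X - R))"
    unfolding e
    by (intro sums_add sums_scaleR_left exp_converges) (rule sums_single[of 0 "\<lambda>_. R"])
  then show ?thesis
    by (simp add: exp_flow_def sums_iff)
qed

lemma exp_flow_relaxation_tendsto:
  fixes F :: "'a \<Rightarrow> 'a::banach"
  assumes "bounded_linear F" "F R = 0" "F X = R - X"
  shows "((\<lambda>t. exp_flow F t X) \<longlongrightarrow> R) at_top"
proof -
  have "((\<lambda>t. exp (- t) :: real) \<longlongrightarrow> 0) at_top"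
    by (rule filterlim_compose[OF exp_at_bot filterlim_uminus_at_bot_at_top])
  then have "((\<lambda>t. R + exp (- t) *\<^sub>R (X - R)) \<longlongrightarrow> R + 0 *\<^sub>R (X - R)) at_top"
    by (intro tendsto_intros)
  then show ?thesis
    by (simp add: exp_flow_relaxation[OF assms])
qed

section \<open>The generator on operators commuting with the projections\<close>

lemma commutator_shifted_sum_eq_0:
  fixes A :: "'i \<Rightarrow> complex ^ 'n ^ 'n"
  assumes "\<And>j. j \<in> I \<Longrightarrow> A j ** X = X ** A j"
  shows "commutator (\<Sum>j\<in>I. A j - g j *\<^sub>R mat 1) X = 0"
proof -
  have "(r *\<^sub>R Y) ** X = r *\<^sub>R (Y ** X)" "X ** (r *\<^sub>R Y) = r *\<^sub>R (X ** Y)"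
    "(Y - Y') ** X = Y ** X - Y' ** X" "X ** (Y - Y') = X ** Y - X ** Y'"
    for r and Y Y' :: "complex ^ 'n ^ 'n"
    by (simp_all add: matrix_matrix_mult_def vec_eq_iff scaleR_sum_right left_diff_distrib
        right_diff_distrib sum_subtractf)
  then have "(A j - g j *\<^sub>R mat 1) ** X = X ** (A j - g j *\<^sub>R mat 1)" if "j \<in> I" for j
    using assms[OF that] by simp
  then show ?thesis
    unfolding commutator_def sum_matrix_mult_left sum_matrix_mult_right by simp
qed

text \<open>The unitary cancels, so the loss terms of the generator see only the projection; the
  unitary enters through the jump term alone.\<close>

lemma dagger_coupling_mult:
  assumes "unitary U" "orthogonal_projection P"
  shows "(U ** P)\<^sup>\<dagger> ** (U ** P) = P"
proof -
  have "(U ** P)\<^sup>\<dagger> ** (U ** P) = P ** (U\<^sup>\<dagger> ** U) ** P"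
    using assms(2) by (simp add: dagger_mult orthogonal_projection_def matrix_mul_assoc)
  then show ?thesis
    using assms by (simp add: unitary_def orthogonal_projection_def)
qed

theorem theorem6:
  fixes M K :: nat
    and d :: "nat \<Rightarrow> nat"
    and conf :: "'n::finite \<Rightarrow> nat \<Rightarrow> nat"
    and Vs Hs U L :: "nat \<Rightarrow> complex ^ 'n ^ 'n"
    and V H :: "complex ^ 'n ^ 'n"
    and g :: "nat \<Rightarrow> real"
    and B :: "(complex ^ 'n) set"
  assumes "tensor_product_labelling M d conf"
    and "\<And>i. i \<in> {1..K} \<Longrightarrow> orthogonal_projection (Vs i)"
    and "\<And>i. i \<in> {1..K} \<Longrightarrow> \<exists>S. acts_on_factors M conf S (Vs i)"
    and "\<And>i j. i \<in> {1..K} \<Longrightarrow> j \<in> {1..K} \<Longrightarrow> i \<noteq> j \<Longrightarrow> commutator (Vs i) (Vs j) = 0"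
    and "\<And>i. i \<in> {1..K} \<Longrightarrow> smallest_eigenvalue (Vs i) 0"
    and "V = (\<Sum>i=1..K. Vs i)"
    and "\<And>i. i \<in> {1..K} \<Longrightarrow> Hs i = Vs i - g i *\<^sub>R mat 1"
    and "\<And>i. i \<in> {1..K} \<Longrightarrow> smallest_eigenvalue (Hs i) (- g i)"
    and "H = (\<Sum>i=1..K. Hs i)"
    and "\<And>i. i \<in> {1..K} \<Longrightarrow> unitary (U i)"
    and "\<And>i. i \<in> {1..K} \<Longrightarrow> L i = U i ** Vs i"
    and "orthonormal_basis_of B (ground_space V)"
    and "\<And>i p. i \<in> {1..K} \<Longrightarrow> p \<in> B \<Longrightarrow> Vs i *v ((U i)\<^sup>\<dagger> *v p) = (U i)\<^sup>\<dagger> *v p"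
    and "\<And>i j p. i \<in> {1..K} \<Longrightarrow> j \<in> {1..K} \<Longrightarrow> j \<noteq> i \<Longrightarrow> p \<in> B \<Longrightarrow>
           Vs j *v ((U i)\<^sup>\<dagger> *v p) = 0"
  shows "correctable V K H L ((\<lambda>i. (U i)\<^sup>\<dagger>) ` {1..K})"
proof -
  note P = assms(2) and comm = assms(4) and small = assms(5) and V = assms(6)
    and un = assms(10) and L = assms(11)
  have B: "vec.span B = ground_space V"
    using assms(12) by (simp add: orthonormal_basis_of_def)
  \<comment> \<open>By linearity, the conditions on basis vectors extend to the whole ground
    space.\<close>
  have fixed: "Vs i *v ((U i)\<^sup>\<dagger> *v v) = (U i)\<^sup>\<dagger> *v v"
    if "i \<in> {1..K}" "v \<in> ground_space V" for i v
    using matrix_vector_eq_on_span[of B "Vs i ** (U i)\<^sup>\<dagger>" "(U i)\<^sup>\<dagger>" v] assms(13) that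
    by (simp add: B flip: matrix_vector_mul_assoc)
  have kill: "Vs j *v ((U i)\<^sup>\<dagger> *v v) = 0"
    if "i \<in> {1..K}" "j \<in> {1..K}" "j \<noteq> i" "v \<in> ground_space V" for i j v
    using matrix_vector_eq_on_span[of B "Vs j ** (U i)\<^sup>\<dagger>" 0 v] assms(14) that
    by (simp add: B flip: matrix_vector_mul_assoc)
  have H: "H = (\<Sum>j=1..K. Vs j - g j *\<^sub>R mat 1)"
    using assms(7) unfolding assms(9) by (intro sum.cong) auto
  let ?F = "lindbladian K H L"
  \<comment> \<open>Taking adjoints turns each left product with a Hermitian operator into the
    corresponding right product.\<close>
  have herm: "X ** Vs j = (Vs j ** X)\<^sup>\<dagger>" if "j \<in> {1..K}" "X\<^sup>\<dagger> = X" for j X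
    using P[OF that(1)] that(2) by (simp add: dagger_mult orthogonal_projection_def)
  have F: "?F X = (\<Sum>j=1..K. U j ** (Vs j ** X ** Vs j) ** (U j)\<^sup>\<dagger>
        - (1/2) *\<^sub>R (Vs j ** X) - (1/2) *\<^sub>R (X ** Vs j))"
    if "\<And>j. j \<in> {1..K} \<Longrightarrow> Vs j ** X = X ** Vs j" for X
  proof -
    \<comment> \<open>The energy offsets are scalar matrices, so commuting with every
      \<open>Vs j\<close> suffices.\<close>
    have "commutator H X = 0"
      unfolding H by (rule commutator_shifted_sum_eq_0) (rule that)
    moreover have "L j ** X ** (L j)\<^sup>\<dagger> = U j ** (Vs j ** X ** Vs j) ** (U j)\<^sup>\<dagger>"
      "(L j)\<^sup>\<dagger> ** L j ** X = Vs j ** X" "X ** (L j)\<^sup>\<dagger> ** L j = X ** Vs j"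
      if j: "j \<in> {1..K}" for j
      using dagger_coupling_mult[OF un[OF j] P[OF j]] P[OF j]
      by (simp_all add: L[OF j] dagger_mult orthogonal_projection_def matrix_mul_assoc)
        (simp add: flip: matrix_mul_assoc)
    ultimately show ?thesis
      by (simp add: lindbladian_def cscale_def map_matrix_def vec_eq_iff)
  qed
  show ?thesis
    unfolding correctable_def
  proof (intro allI impI ballI)
    fix \<rho> E
    assume \<rho>: "density_operator \<rho> \<and> range (\<lambda>v. \<rho> *v v) \<subseteq> ground_space V"
      and "E \<in> (\<lambda>i. (U i)\<^sup>\<dagger>) ` {1..K}"
    then obtain i where i: "i \<in> {1..K}" and E: "E = (U i)\<^sup>\<dagger>" by blast
    define X where "X = (U i)\<^sup>\<dagger> ** \<rho> ** U i"
    have h\<rho>: "\<rho>\<^sup>\<dagger> = \<rho>" and Z: "\<And>v. \<rho> *v v \<in> ground_space V"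
      using \<rho> by (auto simp: density_operator_def)
    have hX: "X\<^sup>\<dagger> = X"
      by (simp add: X_def dagger_mult h\<rho> matrix_mul_assoc)
    have \<rho>0: "Vs j ** \<rho> = 0" "\<rho> ** Vs j = 0" if j: "j \<in> {1..K}" for j
    proof -
      have "Vs j *v (\<rho> *v v) = 0" for v
        by (rule frustration_free[OF P comm small V un fixed kill Z j])
      then show "Vs j ** \<rho> = 0"
        by (simp add: matrix_eq flip: matrix_vector_mul_assoc)
      then show "\<rho> ** Vs j = 0"
        by (simp add: herm[OF j h\<rho>])
    qed
    have Xi: "Vs i ** X = X"
      using fixed[OF i Z] by (simp add: matrix_eq X_def flip: matrix_vector_mul_assoc)
    have Xj: "Vs j ** X = 0" if "j \<in> {1..K}" "j \<noteq> i" for j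
      using kill[OF i that Z] by (simp add: matrix_eq X_def flip: matrix_vector_mul_assoc)
    have iX: "X ** Vs i = X"
      by (simp add: herm[OF i hX] Xi hX)
    have jX: "X ** Vs j = 0" if "j \<in> {1..K}" "j \<noteq> i" for j
      by (simp add: herm[OF that(1) hX] Xj[OF that])
    \<comment> \<open>The jump through channel \<open>i\<close> undoes the error exactly.\<close>
    have "U i ** X ** (U i)\<^sup>\<dagger> = (U i ** (U i)\<^sup>\<dagger>) ** \<rho> ** (U i ** (U i)\<^sup>\<dagger>)"
      by (simp add: X_def matrix_mul_assoc)
    then have UX: "U i ** X ** (U i)\<^sup>\<dagger> = \<rho>"
      using un[OF i] by (simp add: unitary_def)
    have F\<rho>: "?F \<rho> = 0"
      by (subst F) (auto simp: \<rho>0)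
    have "?F X = (\<Sum>j=1..K. U j ** (Vs j ** X ** Vs j) ** (U j)\<^sup>\<dagger>
        - (1/2) *\<^sub>R (Vs j ** X) - (1/2) *\<^sub>R (X ** Vs j))"
    proof (rule F)
      show "Vs j ** X = X ** Vs j" if "j \<in> {1..K}" for j
        using that by (cases "j = i") (simp_all add: Xi iX Xj jX)
    qed
    \<comment> \<open>Only channel \<open>i\<close> contributes: its jump term is
      \<open>\<rho>\<close>, and its two loss terms are each half of \<open>X\<close>.\<close>
    also have "\<dots> = (\<Sum>j=1..K. if j = i then \<rho> - X else 0)"
    proof (rule sum.cong[OF refl])
      fix j assume j: "j \<in> {1..K}"
      show "U j ** (Vs j ** X ** Vs j) ** (U j)\<^sup>\<dagger> - (1/2) *\<^sub>R (Vs j ** X) - (1/2) *\<^sub>R (X ** Vs j)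
          = (if j = i then \<rho> - X else 0)"
        using j by (cases "j = i")
          (simp_all add: Xi iX UX Xj jX diff_diff_eq flip: scaleR_add_left)
    qed
    finally have "?F X = \<rho> - X"
      using i by simp
    then show "((\<lambda>t. exp_flow ?F t (E ** \<rho> ** E\<^sup>\<dagger>)) \<longlongrightarrow> \<rho>) at_top"
      using exp_flow_relaxation_tendsto[OF bounded_linear_lindbladian F\<rho>]
      by (simp add: E X_def)
  qed
qed

end
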